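(* Let $G$ and $H$ be connected graphs. Then the cartesian product $G\square H$ is a hangable graph if and only if both $G$ and $H$ are hangable graphs.
   Context: All graphs are finite, simple, undirected, with nonempty vertex set. For a connected graph $G=(V_G,E_G)$, $d_G(u,v)$ is the length of a shortest $u$--$v$ path. The eccentricity of $v$ is $e_G(v)=\max\{d_G(v,u): u\in V_G\}$ and the diameter is $d(G)=\max\{e_G(v): v\in V_G\}$. The periphery of a vertex $v$ is $P_G(v)=\{u\in V_G: d_G(v,u)=e_G(v)\}$; the periphery of $G$ is $P(G)=\{v\in V_G: e_G(v)=d(G)\}$. A connected graph $G$ is hangable if $P_G(v)\subseteq P(G)$ for every $v\in V_G$. The cartesian product $G\square H$ is the graph with vertex set $V_G\times V_H$ in which $(a,b)$ and $(c,d)$ are adjacent if and only if ($ac\in E_G$ and $b=d$) or ($a=c$ and $bd\in E_H$). *)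

theory Defs
  imports "Graph_Theory.Digraph_Component"
begin

text \<open>
  A finite simple undirected graph is a \<^locale>\<open>pair_graph\<close>: finite vertex set, and each edge
  \<open>{u, v}\<close> represented by the two arcs \<open>(u, v)\<close> and \<open>(v, u)\<close>. Nonemptiness of the vertex set is
  part of the library's \<open>connected\<close>, whose name is qualified because topological spaces
  have a constant of the same name.
\<close>

definition connected_graph :: "'a pair_pre_digraph \<Rightarrow> bool" where
  "connected_graph G \<longleftrightarrow> pair_graph G \<and> Digraph_Component.connected (with_proj G)"

text \<open>\<open>LEAST\<close> is unspecified if there is no path, so this is meaningful on connected graphs only.\<close>

definition gdist :: "'a pair_pre_digraph \<Rightarrow> 'a \<Rightarrow> 'a \<Rightarrow> nat" where
  "gdist G u v = (LEAST n. \<exists>p. pre_digraph.apath (with_proj G) u p v \<and> length p = n)"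

definition eccentricity :: "'a pair_pre_digraph \<Rightarrow> 'a \<Rightarrow> nat" where
  "eccentricity G v = Max {gdist G v u |u. u \<in> pverts G}"

definition graph_diameter :: "'a pair_pre_digraph \<Rightarrow> nat" where
  "graph_diameter G = Max {eccentricity G v |v. v \<in> pverts G}"

definition vertex_periphery :: "'a pair_pre_digraph \<Rightarrow> 'a \<Rightarrow> 'a set" where
  "vertex_periphery G v = {u \<in> pverts G. gdist G v u = eccentricity G v}"

definition periphery :: "'a pair_pre_digraph \<Rightarrow> 'a set" where
  "periphery G = {v \<in> pverts G. eccentricity G v = graph_diameter G}"

definition hangable :: "'a pair_pre_digraph \<Rightarrow> bool" where
  "hangable G \<longleftrightarrow> connected_graph G \<and> (\<forall>v \<in> pverts G. vertex_periphery G v \<subseteq> periphery G)"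

definition cartesian_product ::
  "'a pair_pre_digraph \<Rightarrow> 'b pair_pre_digraph \<Rightarrow> ('a \<times> 'b) pair_pre_digraph" where
  "cartesian_product G H =
    \<lparr> pverts = pverts G \<times> pverts H,
      parcs = {((a, b), (c, d)) |a b c d.
        (a, b) \<in> pverts G \<times> pverts H \<and> (c, d) \<in> pverts G \<times> pverts H \<and>
        ((a, c) \<in> parcs G \<and> b = d \<or> a = c \<and> (b, d) \<in> parcs H)} \<rparr>"

end

(*
  The distance in the product is the sum of the distances in the factors: projecting a walk to the
  two factors splits its steps between them, and conversely two walks can be traversed one
  after the other. Hence eccentricities and diameters add up as well, and, since d(v, u) \<le> e(v)
  and e(v) \<le> d in each factor, equality for the sums forces equality in both factors. So every
  periphery of the product is the product of the peripheries, and the claim reduces to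
  inclusions between products of sets, where those on the left are nonempty.
*)
theory Submission
  imports Defs
begin

text \<open>The two coordinates vary independently, so a maximiser of \<open>f\<close> paired with a
  maximiser of \<open>g\<close> attains the bound. This yields additivity of both eccentricity and
  diameter.\<close>

lemma Max_sum_Times:
  fixes f :: "'a \<Rightarrow> 'c :: linordered_ab_semigroup_add" and g :: "'b \<Rightarrow> 'c"
  assumes "finite A" "A \<noteq> {}" "finite B" "B \<noteq> {}"
  shows "Max ((\<lambda>(a, b). f a + g b) ` (A \<times> B)) = Max (f ` A) + Max (g ` B)"
proof (rule Max_eqI)
  show "finite ((\<lambda>(a, b). f a + g b) ` (A \<times> B))"
    using assms by simp
  show "y \<le> Max (f ` A) + Max (g ` B)" if "y \<in> (\<lambda>(a, b). f a + g b) ` (A \<times> B)" for y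
    using that assms by (auto intro!: add_mono)
  have "Max (f ` A) \<in> f ` A" "Max (g ` B) \<in> g ` B"
    using assms by (simp_all add: Max_in)
  then show "Max (f ` A) + Max (g ` B) \<in> (\<lambda>(a, b). f a + g b) ` (A \<times> B)"
    by force
qed

section \<open>Distances as least exponents of the arc relation\<close>

text \<open>Each round of \<open>awalk_to_apath\<close> only cuts a closed subwalk out of the walk.
  This lets minimisation over paths be replaced by minimisation over walks.\<close>

lemma (in wf_digraph) length_awalk_to_apath:
  assumes "awalk u p v"
  shows "length (awalk_to_apath p) \<le> length p"
  using assms
proof (induct rule: awalk_to_apath_induct)
  case (path p)
  then have "awalk_to_apath p = p"
    by (auto simp: awalk_to_apath.simps)
  then show ?case by simp
next
  case (decomp p q r s)
  have "length (q @ s) \<le> length p"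
    using decomp by (auto elim!: awalk_cyc_decompE)
  then show ?case
    using decomp step_awalk_to_apath[of u p v q r s] by simp
qed

context pair_wf_digraph
begin

text \<open>Relation powers replace arc lists from here on. The condition on \<open>u\<close>
  matters for \<open>n = 0\<close>: the zeroth power relates every value to itself, but an empty
  walk must start at a vertex.\<close>

lemma awalk_length_iff_relpow:
  "(\<exists>p. awalk u p v \<and> length p = n) \<longleftrightarrow> u \<in> pverts G \<and> (u, v) \<in> parcs G ^^ n"
proof (induct n arbitrary: u)
  case 0
  then show ?case by (auto simp: awalk_Nil_iff)
next
  case (Suc n)
  \<comment> \<open>Walks grow at the front, whereas \<open>relpow\<close> unfolds at the end; hence
    \<open>u\<close> is generalised in the induction and the \<open>relpow_Suc_D2\<close> form is
    used below.\<close>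
  have "(\<exists>p. awalk u p v \<and> length p = Suc n) \<longleftrightarrow>
      (\<exists>w. (u, w) \<in> parcs G \<and> (\<exists>p. awalk w p v \<and> length p = n))"
  proof
    assume "\<exists>w. (u, w) \<in> parcs G \<and> (\<exists>p. awalk w p v \<and> length p = n)"
    then obtain w p where "(u, w) \<in> parcs G" "awalk w p v" "length p = n"
      by blast
    then have "awalk u ((u, w) # p) v \<and> length ((u, w) # p) = Suc n"
      by (simp add: awalk_Cons_iff)
    then show "\<exists>p. awalk u p v \<and> length p = Suc n" ..
  qed (auto simp: length_Suc_conv awalk_Cons_iff, blast)
  also have "\<dots> \<longleftrightarrow> (\<exists>w. (u, w) \<in> parcs G \<and> (w, v) \<in> parcs G ^^ n)"
    unfolding Suc by (auto dest: wellformed')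
  also have "\<dots> \<longleftrightarrow> u \<in> pverts G \<and> (u, v) \<in> parcs G ^^ Suc n"
    by (meson in_arcsD1 relpow_Suc_D2 relpow_Suc_I2)
  finally show ?case .
qed

lemma relpow_in_pverts:
  "(u, v) \<in> parcs G ^^ n \<Longrightarrow> u \<in> pverts G \<Longrightarrow> v \<in> pverts G"
  by (cases n) (auto dest: wellformed')

text \<open>Paths are walks, and every walk shortens to a path that is no longer, so both have the
  same minimal length. Reachability ensures that this minimum exists.\<close>

lemma gdist_eq_Least_relpow:
  assumes "u \<in> pverts G" "(u, v) \<in> (parcs G)\<^sup>*"
  shows "gdist G u v = (LEAST n. (u, v) \<in> parcs G ^^ n)"
  unfolding gdist_def
proof (rule Least_equality)
  let ?n = "LEAST n. (u, v) \<in> parcs G ^^ n"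
  have le: "?n \<le> length p" if "apath u p v" for p
    using that awalk_length_iff_relpow[of u v "length p"] by (auto simp: apath_def intro: Least_le)
  have "(u, v) \<in> parcs G ^^ ?n"
    using assms(2) by (metis LeastI_ex rtrancl_imp_relpow)
  then obtain p where "awalk u p v" "length p = ?n"
    using awalk_length_iff_relpow assms(1) by metis
  \<comment> \<open>Removing cycles cannot go below the minimum \<open>?n\<close>, so the shortened
    walk still has length exactly \<open>?n\<close>.\<close>
  then have "apath u (awalk_to_apath p) v \<and> length (awalk_to_apath p) = ?n"
    using le apath_awalk_to_apath length_awalk_to_apath by (metis le_antisym)
  then show "\<exists>p. apath u p v \<and> length p = ?n" ..
  show "\<exists>p. apath u p v \<and> length p = m \<Longrightarrow> ?n \<le> m" for m
    using le by blast
qed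

end

section \<open>Connectedness\<close>

text \<open>The library's \<open>connected\<close> asks for strong connectedness of the symmetric
  closure. The arcs of a \<open>pair_graph\<close> are already symmetric, so reachability is
  unaffected by that closure.\<close>

lemma connected_graph_iff:
  "connected_graph G \<longleftrightarrow> pair_graph G \<and> pverts G \<noteq> {} \<and>
    (\<forall>u \<in> pverts G. \<forall>v \<in> pverts G. (u, v) \<in> (parcs G)\<^sup>*)"
proof (cases "pair_graph G")
  case True
  then interpret pair_graph G .
  have "u \<rightarrow>\<^sup>*\<^bsub>with_proj G\<^esub> v \<longleftrightarrow> (u, v) \<in> (parcs G)\<^sup>*" if "u \<in> pverts G" for u v
    using that awalk_length_iff_relpow[of u v] unfolding reachable_awalk rtrancl_power by blast
  then show ?thesis
    using True
    by (auto simp: connected_graph_def Digraph_Component.connected_def strongly_connected_def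
        reachable_mk_symmetric_eq[OF sym_arcs])
next
  case False
  then show ?thesis by (simp add: connected_graph_def)
qed

section \<open>Walks in the cartesian product\<close>

lemma
  shows pverts_cartesian_product [simp]:
      "pverts (cartesian_product G H) = pverts G \<times> pverts H"
    and parcs_cartesian_product_iff: "((a, b), (c, d)) \<in> parcs (cartesian_product G H) \<longleftrightarrow>
      a \<in> pverts G \<and> b \<in> pverts H \<and> c \<in> pverts G \<and> d \<in> pverts H \<and>
      ((a, c) \<in> parcs G \<and> b = d \<or> a = c \<and> (b, d) \<in> parcs H)"
  by (auto simp: cartesian_product_def)

lemma pair_graph_cartesian_product:
  assumes "pair_graph G" "pair_graph H"
  shows "pair_graph (cartesian_product G H)"
proof -
  interpret G: pair_graph G by fact
  interpret H: pair_graph H by fact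
  let ?V = "pverts G \<times> pverts H"
  have "parcs (cartesian_product G H) \<subseteq> ?V \<times> ?V"
    by (auto simp: cartesian_product_def)
  then have "finite (parcs (cartesian_product G H))"
    by (rule finite_subset) (simp add: G.pair_finite_verts H.pair_finite_verts)
  then show ?thesis
    by unfold_locales
      (auto simp: G.pair_finite_verts H.pair_finite_verts parcs_cartesian_product_iff
        Digraph.symmetric_def sym_def
        dest: G.arcs_symmetric H.arcs_symmetric G.no_loops' H.no_loops')
qed

context
  fixes G :: "'a pair_pre_digraph" and H :: "'b pair_pre_digraph"
  assumes wf_G: "pair_wf_digraph G" and wf_H: "pair_wf_digraph H"
begin

interpretation G: pair_wf_digraph G by (fact wf_G)
interpretation H: pair_wf_digraph H by (fact wf_H)

text \<open>The walk in \<open>G\<close> is copied into the layer over the fixed vertex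
  \<open>b\<close>.\<close>

lemma relpow_cartesian_product_fst:
  "(a, c) \<in> parcs G ^^ n \<Longrightarrow> a \<in> pverts G \<Longrightarrow> b \<in> pverts H \<Longrightarrow>
    ((a, b), (c, b)) \<in> parcs (cartesian_product G H) ^^ n"
  by (induct n arbitrary: c)
    (auto intro!: relcompI simp: parcs_cartesian_product_iff dest: G.wellformed')

lemma relpow_cartesian_product_snd:
  "(b, d) \<in> parcs H ^^ n \<Longrightarrow> a \<in> pverts G \<Longrightarrow> b \<in> pverts H \<Longrightarrow>
    ((a, b), (a, d)) \<in> parcs (cartesian_product G H) ^^ n"
  by (induct n arbitrary: d)
    (auto intro!: relcompI simp: parcs_cartesian_product_iff dest: H.wellformed')

text \<open>Every step in the product moves exactly one coordinate; \<open>i\<close> and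
  \<open>j\<close> count the moves of the first and of the second. Conversely, the walk in
  \<open>G\<close> is made in the layer over \<open>b\<close>, then the walk in \<open>H\<close> in
  the layer over \<open>c\<close>.\<close>

lemma relpow_cartesian_product_iff:
  assumes "a \<in> pverts G" "b \<in> pverts H"
  shows "((a, b), (c, d)) \<in> parcs (cartesian_product G H) ^^ n \<longleftrightarrow>
    (\<exists>i j. n = i + j \<and> (a, c) \<in> parcs G ^^ i \<and> (b, d) \<in> parcs H ^^ j)"
proof
  assume "((a, b), (c, d)) \<in> parcs (cartesian_product G H) ^^ n"
  then show "\<exists>i j. n = i + j \<and> (a, c) \<in> parcs G ^^ i \<and> (b, d) \<in> parcs H ^^ j"
  proof (induct n arbitrary: c d)
    case 0
    then show ?case by auto
  next
    case (Suc n)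
    then obtain c' d' where "((a, b), (c', d')) \<in> parcs (cartesian_product G H) ^^ n"
      and step: "((c', d'), (c, d)) \<in> parcs (cartesian_product G H)"
      by auto
    with Suc obtain i j where "n = i + j" "(a, c') \<in> parcs G ^^ i" "(b, d') \<in> parcs H ^^ j"
      by blast
    moreover from step consider "(c', c) \<in> parcs G" "d' = d" | "c' = c" "(d', d) \<in> parcs H"
      by (auto simp: parcs_cartesian_product_iff)
    ultimately show ?case
      \<comment> \<open>The last step raises either \<open>i\<close> or \<open>j\<close> by one,
        according to the coordinate that moves.\<close>
      by cases (metis add_Suc add_Suc_right relpow_Suc_I)+
  qed
next
  assume "\<exists>i j. n = i + j \<and> (a, c) \<in> parcs G ^^ i \<and> (b, d) \<in> parcs H ^^ j"
  then obtain i j where "n = i + j" and ac: "(a, c) \<in> parcs G ^^ i" and bd: "(b, d) \<in> parcs H ^^ j"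
    by blast
  then show "((a, b), (c, d)) \<in> parcs (cartesian_product G H) ^^ n"
    \<comment> \<open>The second walk starts at \<open>(c, b)\<close>, so \<open>c\<close> has to be
      a vertex of \<open>G\<close>; it is one as the end of a walk from \<open>a\<close>.\<close>
    using relpow_cartesian_product_fst[OF ac assms]
      relpow_cartesian_product_snd[OF bd G.relpow_in_pverts[OF ac assms(1)] assms(2)]
    by (auto simp: relpow_add)
qed

end

lemma connected_graph_cartesian_product:
  assumes "connected_graph G" "connected_graph H"
  shows "connected_graph (cartesian_product G H)"
proof -
  have wf: "pair_wf_digraph G" "pair_wf_digraph H"
    using assms by (auto simp: connected_graph_iff intro: pair_digraph.pair_wf_digraph
        pair_graph.axioms(1))
  have "((a, b), (c, d)) \<in> (parcs (cartesian_product G H))\<^sup>*"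
    if verts: "a \<in> pverts G" "b \<in> pverts H" "c \<in> pverts G" "d \<in> pverts H" for a b c d
  proof -
    obtain i j where "(a, c) \<in> parcs G ^^ i" "(b, d) \<in> parcs H ^^ j"
      using assms verts unfolding connected_graph_iff rtrancl_power by blast
    then show ?thesis
      using relpow_cartesian_product_iff[OF wf] verts by (metis relpow_imp_rtrancl)
  qed
  then show ?thesis
    using assms by (auto simp: connected_graph_iff pair_graph_cartesian_product)
qed

lemma connected_graph_gdist:
  assumes "connected_graph G" "u \<in> pverts G" "v \<in> pverts G"
  shows "gdist G u v = (LEAST n. (u, v) \<in> parcs G ^^ n)"
  using assms by (auto simp: connected_graph_iff pair_graph_def
      intro!: pair_wf_digraph.gdist_eq_Least_relpow pair_digraph.pair_wf_digraph)

section \<open>Eccentricity and periphery in one connected graph\<close>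

context
  fixes G :: "'a pair_pre_digraph"
  assumes conn: "connected_graph G"
begin

lemma finite_pverts: "finite (pverts G)"
  using conn by (auto simp: connected_graph_iff pair_graph_def pair_digraph_def
      pair_fin_digraph.pair_finite_verts)

lemma gdist_le_eccentricity: "u \<in> pverts G \<Longrightarrow> gdist G v u \<le> eccentricity G v"
  using finite_pverts by (auto simp: eccentricity_def intro!: Max_ge)

lemma eccentricity_le_graph_diameter: "v \<in> pverts G \<Longrightarrow> eccentricity G v \<le> graph_diameter G"
  using finite_pverts by (auto simp: graph_diameter_def intro!: Max_ge)

text \<open>A maximum over a finite nonempty set is attained. Nonemptiness later allows an inclusion
  of products to be split into inclusions of the factors.\<close>

lemma vertex_periphery_nonempty: "vertex_periphery G v \<noteq> {}"
proof -
  have "pverts G \<noteq> {}"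
    using conn by (simp add: connected_graph_iff)
  then have "eccentricity G v \<in> {gdist G v u |u. u \<in> pverts G}"
    unfolding eccentricity_def using finite_pverts by (intro Max_in) auto
  then show ?thesis
    by (auto simp: vertex_periphery_def)
qed

end

section \<open>Additivity in the product and product form of the peripheries\<close>

context
  fixes G :: "'a pair_pre_digraph" and H :: "'b pair_pre_digraph"
  assumes conn_G: "connected_graph G" and conn_H: "connected_graph H"
begin

text \<open>The walk lengths in the product are exactly the sums of a walk length in
  \<open>G\<close> and one in \<open>H\<close>, and the least such sum is the sum of the two
  minima.\<close>

lemma gdist_cartesian_product:
  assumes "a \<in> pverts G" "b \<in> pverts H" "c \<in> pverts G" "d \<in> pverts H"
  shows "gdist (cartesian_product G H) (a, b) (c, d) = gdist G a c + gdist H b d"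
proof -
  have wf: "pair_wf_digraph G" "pair_wf_digraph H"
    using conn_G conn_H by (auto simp: connected_graph_iff intro: pair_digraph.pair_wf_digraph
        pair_graph.axioms(1))
  let ?P = "\<lambda>n. \<exists>i j. n = i + j \<and> (a, c) \<in> parcs G ^^ i \<and> (b, d) \<in> parcs H ^^ j"
  have "gdist (cartesian_product G H) (a, b) (c, d) = (LEAST n. ?P n)"
    using connected_graph_gdist[OF connected_graph_cartesian_product[OF conn_G conn_H]] assms
    by (simp add: relpow_cartesian_product_iff[OF wf])
  also have "\<dots> = gdist G a c + gdist H b d"
    unfolding connected_graph_gdist[OF conn_G assms(1,3)] connected_graph_gdist[OF conn_H assms(2,4)]
  proof (rule Least_equality)
    have "(a, c) \<in> (parcs G)\<^sup>*" "(b, d) \<in> (parcs H)\<^sup>*"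
      using conn_G conn_H assms by (auto simp: connected_graph_iff)
    \<comment> \<open>Connectedness makes both sets of exponents nonempty, so both
      \<open>LEAST\<close> values are attained.\<close>
    then show "?P ((LEAST n. (a, c) \<in> parcs G ^^ n) + (LEAST n. (b, d) \<in> parcs H ^^ n))"
      by (metis LeastI_ex rtrancl_imp_relpow)
  qed (auto intro!: add_mono Least_le)
  finally show ?thesis .
qed

lemma eccentricity_cartesian_product:
  assumes "a \<in> pverts G" "b \<in> pverts H"
  shows "eccentricity (cartesian_product G H) (a, b) = eccentricity G a + eccentricity H b"
proof -
  have "{gdist (cartesian_product G H) (a, b) u |u. u \<in> pverts (cartesian_product G H)} =
      (\<lambda>(c, d). gdist G a c + gdist H b d) ` (pverts G \<times> pverts H)"
    using assms by (force simp: gdist_cartesian_product)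
  then show ?thesis
    using Max_sum_Times[OF finite_pverts[OF conn_G] _ finite_pverts[OF conn_H]] assms
    by (subst eccentricity_def) (auto simp: eccentricity_def Setcompr_eq_image)
qed

lemma graph_diameter_cartesian_product:
  "graph_diameter (cartesian_product G H) = graph_diameter G + graph_diameter H"
proof -
  have "{eccentricity (cartesian_product G H) v |v. v \<in> pverts (cartesian_product G H)} =
      (\<lambda>(a, b). eccentricity G a + eccentricity H b) ` (pverts G \<times> pverts H)"
    by (force simp: eccentricity_cartesian_product)
  then show ?thesis
    using Max_sum_Times[OF finite_pverts[OF conn_G] _ finite_pverts[OF conn_H]] conn_G conn_H
    by (subst graph_diameter_def)
      (auto simp: graph_diameter_def Setcompr_eq_image connected_graph_iff)
qed

lemma vertex_periphery_cartesian_product: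
  assumes "a \<in> pverts G" "b \<in> pverts H"
  shows "vertex_periphery (cartesian_product G H) (a, b) =
    vertex_periphery G a \<times> vertex_periphery H b"
proof -
  have "gdist G a c + gdist H b d = eccentricity G a + eccentricity H b \<longleftrightarrow>
      gdist G a c = eccentricity G a \<and> gdist H b d = eccentricity H b"
    if "c \<in> pverts G" "d \<in> pverts H" for c d
    using gdist_le_eccentricity[OF conn_G, of c a] gdist_le_eccentricity[OF conn_H, of d b] that
    by linarith
  then show ?thesis
    using assms
    by (auto simp: vertex_periphery_def gdist_cartesian_product eccentricity_cartesian_product)
qed

lemma periphery_cartesian_product:
  "periphery (cartesian_product G H) = periphery G \<times> periphery H"
proof -
  have "eccentricity G a + eccentricity H b = graph_diameter G + graph_diameter H \<longleftrightarrow>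
      eccentricity G a = graph_diameter G \<and> eccentricity H b = graph_diameter H"
    if "a \<in> pverts G" "b \<in> pverts H" for a b
    using eccentricity_le_graph_diameter[OF conn_G, of a]
      eccentricity_le_graph_diameter[OF conn_H, of b] that
    by linarith
  then show ?thesis
    by (auto simp: periphery_def eccentricity_cartesian_product graph_diameter_cartesian_product)
qed

end

theorem theorem3:
  fixes G :: "'a pair_pre_digraph" and H :: "'b pair_pre_digraph"
  assumes "connected_graph G" and "connected_graph H"
  shows "hangable (cartesian_product G H) \<longleftrightarrow> hangable G \<and> hangable H"
proof -
  \<comment> \<open>The equivalence below quantifies over \<open>a\<close> and \<open>b\<close>
    jointly; a condition on one of them alone can be extracted only if the other has a value to
    range over.\<close>
  have "pverts G \<noteq> {}" "pverts H \<noteq> {}"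
    using assms by (auto simp: connected_graph_iff)
  moreover have "hangable (cartesian_product G H) \<longleftrightarrow>
      (\<forall>a \<in> pverts G. \<forall>b \<in> pverts H.
        vertex_periphery G a \<subseteq> periphery G \<and> vertex_periphery H b \<subseteq> periphery H)"
    using assms
    by (simp add: hangable_def connected_graph_cartesian_product vertex_periphery_cartesian_product
        periphery_cartesian_product times_subset_iff vertex_periphery_nonempty)
  ultimately show ?thesis
    using assms by (auto simp: hangable_def)
qed

end
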